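(* Let $(\ell_n)_{n\in\mathbb{N}}$ be a sequence of positive integers such that for every $n\in\mathbb{N}$ we have $3\le \ell_n\le (\log n)^{1/4}/2$. For each $n$, let $f_n(K_{\ell_n})$ denote the number of labeled graphs on the vertex set $\{1,\dots,n\}$ that do not contain the complete graph $K_{\ell_n}$ as a subgraph. Then $$\log_2 f_n(K_{\ell_n}) = \left(1-\frac{1}{\ell_n-1}\right)\binom{n}{2} + o\!\left(\frac{n^2}{\ell_n}\right)\quad\text{as } n\to\infty.$$
   Context: Here $\log$ denotes the natural logarithm. A graph is $K_\ell$-free if it contains no (not necessarily induced) subgraph isomorphic to the complete graph $K_\ell$ on $\ell$ vertices. The term $o(n^2/\ell_n)$ denotes a quantity $g(n)$ with $g(n)\ell_n/n^2\to 0$ as $n\to\infty$. *)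

theory Defs
  imports Complex_Main "HOL-Library.Ramsey"
begin

text \<open>A simple graph is a pair of a vertex set and a set of two-element subsets of it.\<close>

type_synonym 'a graph = "'a set \<times> 'a set set"

definition is_graph :: "'a graph \<Rightarrow> bool" where
  "is_graph G \<longleftrightarrow> snd G \<subseteq> [fst G]\<^bsup>2\<^esup>"

definition subgraph :: "'a graph \<Rightarrow> 'a graph \<Rightarrow> bool" where
  "subgraph H G \<longleftrightarrow> is_graph H \<and> is_graph G \<and> fst H \<subseteq> fst G \<and> snd H \<subseteq> snd G"

definition graph_isomorphic :: "'a graph \<Rightarrow> 'b graph \<Rightarrow> bool" where
  "graph_isomorphic G H \<longleftrightarrow>
     (\<exists>\<phi>. bij_betw \<phi> (fst G) (fst H) \<and>
          (\<forall>u\<in>fst G. \<forall>v\<in>fst G. {u, v} \<in> snd G \<longleftrightarrow> {\<phi> u, \<phi> v} \<in> snd H))"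

definition graph_free :: "'b graph \<Rightarrow> 'a graph \<Rightarrow> bool" where
  "graph_free H G \<longleftrightarrow> \<not> (\<exists>G'. subgraph G' G \<and> graph_isomorphic G' H)"

definition complete_graph :: "nat \<Rightarrow> nat graph" where
  "complete_graph l = ({1..l}, [{1..l}]\<^bsup>2\<^esup>)"

definition num_free_graphs :: "nat \<Rightarrow> 'b graph \<Rightarrow> nat" where
  "num_free_graphs n H =
     card {G :: nat graph. is_graph G \<and> fst G = {1..n} \<and> graph_free H G}"

end

theory Submission
  imports Defs "HOL-Library.FuncSet" "HOL-Real_Asymp.Real_Asymp"
begin

text \<open>
  A dense container argument. For a \<open>K\<^sub>l\<close>-free subgraph \<open>G\<close> of a host graph \<open>C\<close>, consider the maps of
  \<open>l\<close> indices to vertices that send the pairs in \<open>Q\<close> to edges of \<open>G\<close> and the other pairs to edges of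
  \<open>C\<close>. If \<open>C\<close> has clearly more edges than the Turan graph, there are many such maps for \<open>Q = {}\<close>, while
  there are none when \<open>Q\<close> contains all pairs. Hence adding some pair \<open>(a, b)\<close> to some \<open>Q\<close> reduces their
  number by a factor \<open>\<rho>\<close> while it is still large. Fixing the images of the other indices suitably gives
  vertex sets \<open>X\<close> and \<open>Z\<close> such that \<open>C\<close> has many edges between \<open>X\<close> and \<open>Z\<close>, of which only a fraction
  \<open>4 \<rho>\<close> lies in \<open>G\<close>. Recording \<open>X\<close>, \<open>Z\<close> and these few edges of \<open>G\<close>, and deleting all edges
  between \<open>X\<close> and \<open>Z\<close> from \<open>C\<close>, one repeats until \<open>C\<close> has about as many edges as the Turan graph.
  With \<open>n\<close> vertices and \<open>\<rho> = 1 / (ln n)\<^sup>2\<close> the recorded information is negligible. The lower bound counts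
  the subgraphs of the Turan graph.
\<close>

section \<open>Clique maps and counting of small sets\<close>

text \<open>The edge condition may vary with the index pair, so that some pairs can be required in
  \<open>G\<close> and the others only in \<open>C\<close>. Extensionality makes each map count
  once.\<close>

definition clique_maps :: "'a set \<Rightarrow> nat \<Rightarrow> (nat \<Rightarrow> nat \<Rightarrow> 'a set set) \<Rightarrow> (nat \<Rightarrow> 'a) set" where
  "clique_maps V l E = {w \<in> {..<l} \<rightarrow>\<^sub>E V. \<forall>b<l. \<forall>a<b. {w a, w b} \<in> E a b}"

lemma finite_clique_maps: "finite V \<Longrightarrow> finite (clique_maps V l E)"
  by (simp add: clique_maps_def finite_PiE)

lemma clique_maps_mono:
  assumes "V \<subseteq> V'" and "\<And>a b. E a b \<subseteq> E' a b"
  shows "clique_maps V l E \<subseteq> clique_maps V' l E'"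
  using assms unfolding clique_maps_def PiE_def Pi_def by fastforce

text \<open>Each such set results from \<open>m\<close> successive choices, each adding an element
  of \<open>R\<close> or, for \<open>None\<close>, nothing.\<close>

lemma card_small_subsets_le:
  assumes "finite R"
  shows "card {A. A \<subseteq> R \<and> card A \<le> m} \<le> (card R + 1) ^ m"
proof (induction m)
  case 0
  have "{A. A \<subseteq> R \<and> card A \<le> 0} = {{}}"
    using assms finite_subset by fastforce
  then show ?case by simp
next
  case (Suc m)
  let ?S = "\<lambda>m. {A. A \<subseteq> R \<and> card A \<le> m}"
  let ?f = "\<lambda>(p, A). case p of None \<Rightarrow> A | Some x \<Rightarrow> insert x A"
  let ?O = "insert None (Some ` R)"
  have fin: "finite (?S m)"
    using assms by simp
  have "?S (Suc m) \<subseteq> ?f ` (?O \<times> ?S m)"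
  proof
    fix A assume A: "A \<in> ?S (Suc m)"
    show "A \<in> ?f ` (?O \<times> ?S m)"
    proof (cases "card A \<le> m")
      case True
      then show ?thesis using A by (intro image_eqI[of _ _ "(None, A)"]) auto
    next
      case False
      then obtain x where x: "x \<in> A" by fastforce
      have "finite A" using A assms finite_subset by auto
      then show ?thesis using A x
        by (intro image_eqI[of _ _ "(Some x, A - {x})"]) auto
    qed
  qed
  then have "card (?S (Suc m)) \<le> card (?O \<times> ?S m)"
    using assms fin by (intro surj_card_le) auto
  also have "\<dots> = (card R + 1) * card (?S m)"
    using assms by (simp add: card_cartesian_product card_image)
  also have "\<dots> \<le> (card R + 1) * (card R + 1) ^ m"
    using Suc by (rule mult_le_mono2)
  finally show ?case by simp
qed

lemma card_pairs_le:
  assumes "finite R" and "R \<subseteq> [V]\<^bsup>2\<^esup>"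
  shows "card {(x, y). {x, y} \<in> R} \<le> 2 * card R"
proof -
  have e2: "card {(x, y). {x, y} = e} \<le> 2" if eR: "e \<in> R" for e
  proof -
    obtain p q where e: "e = {p, q}"
      using subsetD[OF assms(2) eR] by (auto elim: nsets2_E)
    have s: "{(x, y). {x, y} = e} \<subseteq> {(p, q), (q, p)}"
      unfolding e by (auto simp: doubleton_eq_iff)
    have "card {(x, y). {x, y} = e} \<le> card {(p, q), (q, p)}"
      using s by (intro card_mono) auto
    also have "\<dots> \<le> 2" using card_length[of "[(p, q), (q, p)]"] by simp
    finally show ?thesis .
  qed
  have "{(x, y). {x, y} \<in> R} = (\<Union>e\<in>R. {(x, y). {x, y} = e})" by auto
  then have "card {(x, y). {x, y} \<in> R} \<le> (\<Sum>e\<in>R. card {(x, y). {x, y} = e})"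
    using card_UN_le[OF assms(1)] by metis
  also have "\<dots> \<le> (\<Sum>e\<in>R. 2)" using e2 by (intro sum_mono) auto
  finally show ?thesis by simp
qed

subsection \<open>Supersaturation\<close>

text \<open>Delete vertices of degree below \<open>d\<close> times the current order n. Each
  deletion costs less than d n edges, and \<open>d * (n ^ 2 + n) / 2\<close> is the sum of these
  bounds down to order 0. The surplus above \<open>s ^ 2 / 2\<close> survives, and fewer than
  \<open>s\<close> vertices have no room for it, so the process stops in time.\<close>

lemma low_degree_deletion:
  fixes d s :: real
  assumes "finite V" and "C \<subseteq> [V]\<^bsup>2\<^esup>" and "0 \<le> d"
    and "real (card C) > d * (real (card V) ^ 2 + real (card V)) / 2 + s ^ 2 / 2"
  shows "\<exists>W\<subseteq>V. s \<le> real (card W) \<and> (\<forall>v\<in>W. d * real (card W) \<le> real (card {x \<in> W. {v, x} \<in> C}))"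
  using assms
proof (induction "card V" arbitrary: V C)
  case 0
  then have "C = {}" using nsets_eq_empty[of V 2] by auto
  then have "s ^ 2 < 0" using 0 by auto
  then show ?case by simp
next
  case (Suc m)
  let ?n = "real (card V)"
  let ?N = "\<lambda>v. {x \<in> V. {v, x} \<in> C}"
  show ?case
  proof (cases "\<forall>v\<in>V. d * ?n \<le> real (card (?N v))")
    case True
    have "card C \<le> card V choose 2"
      using Suc.prems by (metis card_mono card_nsets finite_imp_finite_nsets)
    then have "2 * card C \<le> card V * (card V - 1)"
      unfolding choose_two by linarith
    also have "\<dots> \<le> card V * card V" by simp
    finally have "2 * card C \<le> card V * card V" .
    then have "2 * real (card C) \<le> ?n ^ 2"
      unfolding power2_eq_square by (simp flip: of_nat_mult)
    moreover have "0 \<le> d * (?n ^ 2 + ?n)" using Suc.prems(3) by simp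
    ultimately have "s ^ 2 < ?n ^ 2" using Suc.prems(4) by linarith
    then have "s \<le> ?n" by (meson less_imp_le of_nat_0_le_iff power_less_imp_less_base)
    then show ?thesis using True by blast
  next
    case False
    then obtain v where v: "v \<in> V" and dv: "real (card (?N v)) < d * ?n"
      by (auto simp: not_le)
    let ?D = "{e \<in> C. v \<in> e}"
    have sub: "C - ?D \<subseteq> [V - {v}]\<^bsup>2\<^esup>"
      using Suc.prems(2) unfolding nsets_def by auto
    have fC: "finite C" using Suc.prems finite_imp_finite_nsets finite_subset by metis
    have "?D \<subseteq> (\<lambda>x. {v, x}) ` ?N v"
    proof
      fix e assume e: "e \<in> ?D"
      then have "e \<in> [V]\<^bsup>2\<^esup>" using Suc.prems(2) by auto
      then obtain p q where pq: "e = {p, q}" "p \<in> V" "q \<in> V"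
        unfolding nsets_def by (auto simp: card_2_iff)
      then have "v = p \<or> v = q" using e by auto
      then show "e \<in> (\<lambda>x. {v, x}) ` ?N v"
        using pq e by (auto simp: insert_commute)
    qed
    then have D: "card ?D \<le> card (?N v)"
      using Suc.prems(1) by (intro surj_card_le) auto
    have "card C = card (C - ?D) + card ?D"
      using fC by (simp add: card_Diff_subset card_mono)
    then have "real (card C) < real (card (C - ?D)) + d * ?n" using D dv by linarith
    moreover have n: "?n = real m + 1" "card (V - {v}) = m"
      using Suc.hyps(2) v Suc.prems(1) by auto
    \<comment> \<open>The threshold falls by exactly \<open>d * (real m + 1)\<close>, the bound for
      the deleted edges, so the surplus is untouched.\<close>
    ultimately have "real (card (C - ?D)) > d * (real m ^ 2 + real m) / 2 + s ^ 2 / 2"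
      using Suc.prems(4) by (simp add: power2_eq_square algebra_simps add_divide_distrib)
    then obtain W where W: "W \<subseteq> V - {v}" "s \<le> real (card W)"
      "\<forall>u\<in>W. d * real (card W) \<le> real (card {x \<in> W. {u, x} \<in> C - ?D})"
      using Suc.hyps(1)[of "V - {v}" "C - ?D"] Suc.prems(1,3) sub n by auto
    have "real (card {x \<in> W. {u, x} \<in> C - ?D}) \<le> real (card {x \<in> W. {u, x} \<in> C})" for u
      using W(1) Suc.prems(1) finite_subset by (intro of_nat_mono card_mono) (auto intro: finite_subset)
    then show ?thesis using W by (intro exI[of _ W]) (auto intro: order_trans)
  qed
qed

text \<open>The images are chosen one after another. Each earlier image rules out at most
  \<open>c * card W\<close> vertices and at most \<open>l - 1\<close> images precede, so
  \<open>\<gamma> * card W\<close> choices always remain.\<close>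

lemma greedy_clique_maps:
  fixes c \<gamma> :: real
  assumes "finite W" and C: "\<And>v. v \<in> W \<Longrightarrow> real (card {x \<in> W. {v, x} \<notin> C}) \<le> c * real (card W)"
    and "0 \<le> \<gamma>" and "0 \<le> c" and "c * (real l - 1) \<le> 1 - \<gamma>"
  shows "(\<gamma> * real (card W)) ^ l \<le> real (card (clique_maps W l (\<lambda>_ _. C)))"
  using assms(5)
proof (induction l)
  case 0
  have "clique_maps W 0 (\<lambda>_ _. C) = {\<lambda>_. undefined}" by (auto simp: clique_maps_def)
  then show ?case by simp
next
  case (Suc l)
  let ?M = "clique_maps W l (\<lambda>_ _. C)"
  let ?N = "\<lambda>w. {x \<in> W. \<forall>j<l. {w j, x} \<in> C}"
  let ?m = "real (card W)"
  have c: "c * real l \<le> 1 - \<gamma>" using Suc.prems by simp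
  then have IH: "(\<gamma> * ?m) ^ l \<le> real (card ?M)"
    using Suc.IH assms(4) by (simp add: algebra_simps)
  have fM: "finite ?M" using assms(1) by (rule finite_clique_maps)
  have N: "\<gamma> * ?m \<le> real (card (?N w))" if w: "w \<in> ?M" for w
  proof -
    have wW: "w j \<in> W" if "j < l" for j using w that by (auto simp: clique_maps_def PiE_def Pi_def)
    have "W \<subseteq> ?N w \<union> (\<Union>j<l. {x \<in> W. {w j, x} \<notin> C})" by auto
    then have "card W \<le> card (?N w \<union> (\<Union>j<l. {x \<in> W. {w j, x} \<notin> C}))"
      using assms(1) by (intro card_mono) auto
    also have "\<dots> \<le> card (?N w) + card (\<Union>j<l. {x \<in> W. {w j, x} \<notin> C})" by (rule card_Un_le)
    also have "\<dots> \<le> card (?N w) + (\<Sum>j<l. card {x \<in> W. {w j, x} \<notin> C})"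
      by (intro add_left_mono card_UN_le) simp
    finally have "?m \<le> real (card (?N w)) + (\<Sum>j<l. real (card {x \<in> W. {w j, x} \<notin> C}))"
      by (simp flip: of_nat_sum of_nat_add)
    also have "\<dots> \<le> real (card (?N w)) + (\<Sum>j<l. c * ?m)"
      using wW C by (intro add_left_mono sum_mono) auto
    finally have "?m \<le> real (card (?N w)) + (c * real l) * ?m" by (simp add: mult_ac)
    moreover have "(c * real l) * ?m \<le> (1 - \<gamma>) * ?m" using c by (intro mult_right_mono) auto
    ultimately show ?thesis by (simp add: algebra_simps)
  qed
  let ?f = "\<lambda>(w, x). w(l := x)"
  have inj: "inj_on ?f (Sigma ?M ?N)"
  proof (rule inj_onI, clarify)
    fix w x w' x' assume w: "w \<in> ?M" "w' \<in> ?M" and eq: "w(l := x) = w'(l := x')"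
    \<comment> \<open>Both maps have the default value at \<open>l\<close>, so the update overwrites
      no information.\<close>
    have "w l = undefined" "w' l = undefined" using w by (auto simp: clique_maps_def PiE_def extensional_def)
    then have "w j = w' j" for j using fun_cong[OF eq, of j] by (cases "j = l") auto
    then show "w = w' \<and> x = x'" using fun_cong[OF eq, of l] by auto
  qed
  have sub: "?f ` Sigma ?M ?N \<subseteq> clique_maps W (Suc l) (\<lambda>_ _. C)"
    by (auto simp: clique_maps_def PiE_def Pi_def extensional_def less_Suc_eq)
  have "(\<gamma> * ?m) ^ Suc l \<le> real (card ?M) * (\<gamma> * ?m)"
    using IH assms(3) by (simp add: mult_ac mult_left_mono)
  also have "\<dots> = (\<Sum>w\<in>?M. \<gamma> * ?m)" by simp
  also have "\<dots> \<le> (\<Sum>w\<in>?M. real (card (?N w)))" using N by (rule sum_mono)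
  also have "\<dots> = real (card (Sigma ?M ?N))" using fM assms(1) by simp
  also have "\<dots> = real (card (?f ` Sigma ?M ?N))" using inj by (simp add: card_image)
  also have "\<dots> \<le> real (card (clique_maps W (Suc l) (\<lambda>_ _. C)))"
    using sub assms(1) by (intro of_nat_mono card_mono finite_clique_maps) auto
  finally show ?case .
qed

text \<open>Deletion with \<open>s = \<gamma> * card V\<close> leaves a set \<open>W\<close> in
  which each vertex misses at most a fraction \<open>1 / (l - 1) - \<gamma>\<close>. The greedy
  choice then has at least \<open>\<gamma> * card W\<close>, hence
  \<open>\<gamma> ^ 2 * card V\<close>, options per index.\<close>

lemma clique_supersaturation:
  fixes \<gamma> :: real
  assumes "finite V" and "C \<subseteq> [V]\<^bsup>2\<^esup>" and "2 \<le> l" and "0 \<le> \<gamma>" and "\<gamma> \<le> 1 / (real l - 1)"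
    and "real (card C) > (1 - 1 / (real l - 1) + \<gamma>) * (real (card V) ^ 2 + real (card V)) / 2
           + (\<gamma> * real (card V)) ^ 2 / 2"
  shows "(\<gamma> ^ 2 * real (card V)) ^ l \<le> real (card (clique_maps V l (\<lambda>_ _. C)))"
proof -
  let ?d = "1 - 1 / (real l - 1) + \<gamma>"
  have l1: "1 \<le> real l - 1" using assms(3) by linarith
  then have "1 / (real l - 1) \<le> 1" by simp
  then have "0 \<le> ?d" using assms(4) by linarith
  from low_degree_deletion[OF assms(1,2) this assms(6)]
  obtain W where W: "W \<subseteq> V" "\<gamma> * real (card V) \<le> real (card W)"
    "\<And>v. v \<in> W \<Longrightarrow> ?d * real (card W) \<le> real (card {x \<in> W. {v, x} \<in> C})" by blast
  have fW: "finite W" using W(1) assms(1) finite_subset by blast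
  have "real (card {x \<in> W. {v, x} \<notin> C}) \<le> (1 - ?d) * real (card W)" if "v \<in> W" for v
  proof -
    have "card W = card {x \<in> W. {v, x} \<in> C} + card {x \<in> W. {v, x} \<notin> C}"
      using fW by (subst card_Un_disjoint[symmetric]) (auto intro: arg_cong[of _ _ card])
    then show ?thesis using W(3)[OF that] by (simp add: algebra_simps)
  qed
  moreover have "(1 - ?d) * (real l - 1) \<le> 1 - \<gamma>"
  proof -
    have "(1 - ?d) * (real l - 1) = 1 - \<gamma> * (real l - 1)" using l1 by (simp add: field_simps)
    moreover have "\<gamma> * 1 \<le> \<gamma> * (real l - 1)" using l1 assms(4) by (rule mult_left_mono)
    ultimately show ?thesis by simp
  qed
  ultimately have "(\<gamma> * real (card W)) ^ l \<le> real (card (clique_maps W l (\<lambda>_ _. C)))"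
    using assms(4,5) fW by (intro greedy_clique_maps[where c = "1 - ?d"]) auto
  moreover have "(\<gamma> ^ 2 * real (card V)) ^ l \<le> (\<gamma> * real (card W)) ^ l"
    using W(2) assms(4) by (intro power_mono) (auto simp: power2_eq_square mult.assoc mult_left_mono)
  moreover have "card (clique_maps W l (\<lambda>_ _. C)) \<le> card (clique_maps V l (\<lambda>_ _. C))"
    using W(1) assms(1) by (intro card_mono finite_clique_maps clique_maps_mono) auto
  ultimately show ?thesis by linarith
qed

subsection \<open>Containers\<close>

text \<open>If every single addition kept more than a fraction \<open>\<rho>\<close> while
  \<open>H\<close> is above the threshold, building up \<open>S\<close> element by element would end
  with a positive \<open>H S\<close>.\<close>

lemma sharp_drop_in_chain:
  fixes H :: "'b set \<Rightarrow> real"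
  assumes "finite S" and "0 < \<rho>" and "\<rho> \<le> 1" and "0 < H {}" and "H S \<le> 0"
  shows "\<exists>Q e. Q \<subseteq> S \<and> e \<in> S \<and> e \<notin> Q \<and> \<rho> ^ card S * H {} \<le> H Q \<and> H (insert e Q) \<le> \<rho> * H Q"
proof (rule ccontr)
  assume "\<not> ?thesis"
  then have step: "\<rho> * H Q < H (insert e Q)"
    if "Q \<subseteq> S" "e \<in> S" "e \<notin> Q" "\<rho> ^ card S * H {} \<le> H Q" for Q e
    using that not_le by blast
  have "\<rho> ^ card Q * H {} \<le> H Q" if "Q \<subseteq> S" for Q
    using finite_subset[OF that assms(1)] that
  proof (induction Q)
    case empty
    then show ?case by simp
  next
    case (insert e Q)
    then have IH: "\<rho> ^ card Q * H {} \<le> H Q" by simp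
    \<comment> \<open>As \<open>\<rho> \<le> 1\<close>, the inductive bound for \<open>Q\<close>
      lies above the threshold, so \<open>step\<close> applies.\<close>
    have "\<rho> ^ card S \<le> \<rho> ^ card Q"
      using insert.prems assms by (intro power_decreasing card_mono) auto
    then have "\<rho> ^ card S * H {} \<le> \<rho> ^ card Q * H {}"
      using assms(4) by (simp add: mult_right_mono)
    then have "\<rho> * H Q < H (insert e Q)"
      using insert IH by (intro step) auto
    moreover have "\<rho> * (\<rho> ^ card Q * H {}) \<le> \<rho> * H Q"
      using IH assms(2) by (intro mult_left_mono) auto
    ultimately show ?case using insert by (simp add: mult_ac)
  qed
  then have "\<rho> ^ card S * H {} \<le> H S" by simp
  moreover have "0 < \<rho> ^ card S * H {}" using assms(2,4) by simp
  ultimately show False using assms(5) by linarith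
qed

text \<open>The two sets may overlap. Given \<open>C\<close>, the result depends on two vertex sets
  only, which leaves at most \<open>4 ^ card V\<close> possibilities inside
  \<open>V\<close>.\<close>

definition edges_between :: "'a set set \<Rightarrow> 'a set \<Rightarrow> 'a set \<Rightarrow> 'a set set" where
  "edges_between C X Z = {e \<in> C. \<exists>x\<in>X. \<exists>z\<in>Z. e = {x, z}}"

text \<open>A sharp drop in the number of clique maps is caused by a single pair
  \<open>(a, b)\<close>. Averaging over the images of the other indices finds one assignment at
  which the drop is still visible, and there the maps become edges between two vertex sets.\<close>

lemma sparse_dense_spot:
  fixes \<rho> \<eta> :: real
  assumes V: "finite V" "V \<noteq> {}" and C: "C \<subseteq> [V]\<^bsup>2\<^esup>" and G: "G \<subseteq> C"
    and free: "clique_maps V l (\<lambda>_ _. G) = {}" and \<rho>: "0 < \<rho>" "\<rho> \<le> 1" and \<eta>: "0 < \<eta>"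
    and many: "\<eta> * real (card V) ^ l \<le> real (card (clique_maps V l (\<lambda>_ _. C)))"
  shows "\<exists>X\<subseteq>V. \<exists>Z\<subseteq>V. \<rho> ^ (l * l) * \<eta> * real (card V) ^ 2 / 4 \<le> real (card (edges_between C X Z))
    \<and> real (card (edges_between C X Z \<inter> G)) \<le> 4 * \<rho> * real (card (edges_between C X Z))"
proof -
  let ?n = "real (card V)"
  define S where "S = {(a, b). a < b \<and> b < l}"
  define M where "M = (\<lambda>Q. clique_maps V l (\<lambda>a b. if (a, b) \<in> Q then G else C))"
  define H where "H = (\<lambda>Q. real (card (M Q)))"
  have n: "0 < ?n" using V by (simp add: card_gt_0_iff)
  have S_sub: "S \<subseteq> {..<l} \<times> {..<l}" by (auto simp: S_def)
  then have fS: "finite S" and cS: "card S \<le> l * l"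
    using finite_subset card_mono[OF _ S_sub] by (auto simp: card_cartesian_product)
  have M0: "M {} = clique_maps V l (\<lambda>_ _. C)" by (simp add: M_def)
  have MS: "M S = clique_maps V l (\<lambda>_ _. G)" by (auto simp: M_def S_def clique_maps_def)
  have "0 < \<eta> * ?n ^ l" using \<eta> n by simp
  then have H0: "0 < H {}" "\<eta> * ?n ^ l \<le> H {}" using many M0 by (auto simp: H_def)
  have HS: "H S \<le> 0" using free MS by (simp add: H_def)
  obtain Q e where Q: "Q \<subseteq> S" "e \<in> S" "e \<notin> Q"
    and low: "\<rho> ^ card S * H {} \<le> H Q" and drop: "H (insert e Q) \<le> \<rho> * H Q"
    using sharp_drop_in_chain[OF fS \<rho> H0(1) HS] by blast
  obtain a b where e: "e = (a, b)" "a < b" "b < l" using Q(2) by (auto simp: S_def)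
  \<comment> \<open>There are \<open>?n ^ (l - 2)\<close> ways to fix the other images, so an
    average fibre has at least \<open>2 * \<beta> * ?n ^ 2\<close> maps; half of that is asked of
    the chosen one.\<close>
  define \<beta> where "\<beta> = \<rho> ^ (l * l) * \<eta> / 2"
  have "2 * \<beta> * ?n ^ l = \<rho> ^ (l * l) * (\<eta> * ?n ^ l)" by (simp add: \<beta>_def)
  also have "\<dots> \<le> \<rho> ^ card S * (\<eta> * ?n ^ l)"
    using cS \<rho> \<open>0 < \<eta> * ?n ^ l\<close> by (intro mult_right_mono power_decreasing) auto
  also have "\<dots> \<le> \<rho> ^ card S * H {}" using H0 \<rho> by (intro mult_left_mono) auto
  finally have HQ: "2 * \<beta> * ?n ^ l \<le> H Q" using low by linarith
  define J where "J = {..<l} - {a, b}"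
  define U where "U = J \<rightarrow>\<^sub>E V"
  \<comment> \<open>\<open>F u\<close> collects the maps that agree with \<open>u\<close> away from
    \<open>a\<close> and \<open>b\<close>, and \<open>F' u\<close> those among them that survive the
    new constraint.\<close>
  define F where "F = (\<lambda>u. {w \<in> M Q. restrict w J = u})"
  define F' where "F' = (\<lambda>u. {w \<in> F u. {w a, w b} \<in> G})"
  have fM: "finite (M Q')" for Q' using V by (simp add: M_def finite_clique_maps)
  have fF: "finite (F u)" for u using fM by (simp add: F_def)
  have fU: "finite U" and U0: "U \<noteq> {}" using V by (auto simp: U_def J_def finite_PiE PiE_eq_empty_iff)
  have cU: "?n ^ 2 * real (card U) = ?n ^ l"
  proof -
    have "card J = l - 2" using e by (simp add: J_def card_Diff_subset)
    then have "card U = card V ^ (l - 2)" by (simp add: U_def J_def card_PiE)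
    moreover have "2 + (l - 2) = l" using e by linarith
    ultimately show ?thesis by (metis of_nat_power power_add)
  qed
  have MU: "restrict w J \<in> U" if "w \<in> M Q" for w
    using that by (auto simp: M_def U_def J_def clique_maps_def PiE_def Pi_def)
  have M': "M (insert e Q) = {w \<in> M Q. {w a, w b} \<in> G}"
    using G e Q(3) by (auto simp: M_def clique_maps_def split: if_splits)
  have fibres: "card {w \<in> M Q. P w} = (\<Sum>u\<in>U. card {w \<in> F u. P w})" for P
  proof -
    have "{w \<in> M Q. P w} = (\<Union>u\<in>U. {w \<in> F u. P w})" using MU by (auto simp: F_def)
    also have "card \<dots> = (\<Sum>u\<in>U. card {w \<in> F u. P w})"
      using fU fM by (intro card_UN_disjoint) (auto simp: F_def)
    finally show ?thesis .
  qed
  have sumF: "H Q = (\<Sum>u\<in>U. real (card (F u)))"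
    using fibres[of "\<lambda>_. True"] by (simp add: H_def)
  have sumF': "H (insert e Q) = (\<Sum>u\<in>U. real (card (F' u)))"
    using fibres[of "\<lambda>w. {w a, w b} \<in> G"] by (simp add: H_def M' F'_def)
  \<comment> \<open>Otherwise \<open>card (F' u)\<close> exceeds
    \<open>2 * \<rho> * (card (F u) - \<beta> * ?n ^ 2)\<close> for every \<open>u\<close>, for
    small fibres because this is negative. Summing and using \<open>HQ\<close> contradicts
    \<open>drop\<close>.\<close>
  have "\<exists>u\<in>U. \<beta> * ?n ^ 2 \<le> real (card (F u)) \<and> real (card (F' u)) \<le> 2 * \<rho> * real (card (F u))"
  proof (rule ccontr)
    assume no: "\<not> ?thesis"
    have \<beta>0: "0 \<le> \<beta> * ?n ^ 2" using \<rho> \<eta> by (simp add: \<beta>_def)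
    have "2 * \<rho> * (real (card (F u)) - \<beta> * ?n ^ 2) < real (card (F' u))" if u: "u \<in> U" for u
    proof (cases "\<beta> * ?n ^ 2 \<le> real (card (F u))")
      case True
      have "2 * \<rho> * (real (card (F u)) - \<beta> * ?n ^ 2) \<le> 2 * \<rho> * real (card (F u))"
        using \<rho> \<beta>0 by (intro mult_left_mono) auto
      then show ?thesis using no True u by force
    next
      case False
      then have "2 * \<rho> * (real (card (F u)) - \<beta> * ?n ^ 2) < 0"
        using \<rho> by (intro mult_pos_neg) auto
      then show ?thesis by linarith
    qed
    then have "(\<Sum>u\<in>U. 2 * \<rho> * (real (card (F u)) - \<beta> * ?n ^ 2)) < H (insert e Q)"
      unfolding sumF' using fU U0 by (intro sum_strict_mono) auto
    moreover have "(\<Sum>u\<in>U. 2 * \<rho> * (real (card (F u)) - \<beta> * ?n ^ 2))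
        = 2 * \<rho> * (H Q - \<beta> * (?n ^ 2 * real (card U)))"
      by (simp add: sumF sum_distrib_left[symmetric] sum_subtractf)
    ultimately have "2 * \<rho> * (H Q - \<beta> * ?n ^ l) < \<rho> * H Q" using drop cU by simp
    then have "\<rho> * (H Q) < \<rho> * (2 * \<beta> * ?n ^ l)" by (simp add: algebra_simps)
    then have "H Q < 2 * \<beta> * ?n ^ l" using \<rho> by simp
    then show False using HQ by simp
  qed
  then obtain u where u: "\<beta> * ?n ^ 2 \<le> real (card (F u))" "real (card (F' u)) \<le> 2 * \<rho> * real (card (F u))"
    by blast
  define X where "X = (\<lambda>w. w a) ` F u"
  define Z where "Z = (\<lambda>w. w b) ` F u"
  define R where "R = (\<lambda>w. {w a, w b}) ` F u"
  have FV: "w a \<in> V" "w b \<in> V" "{w a, w b} \<in> C" if "w \<in> F u" for w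
  proof -
    have w: "w \<in> {..<l} \<rightarrow>\<^sub>E V" "\<forall>j<l. \<forall>i<j. {w i, w j} \<in> (if (i, j) \<in> Q then G else C)"
      using that by (auto simp: F_def M_def clique_maps_def)
    then show "w a \<in> V" "w b \<in> V" using e by (auto simp: PiE_def Pi_def)
    have "{w a, w b} \<in> (if (a, b) \<in> Q then G else C)" using w(2) e by blast
    then show "{w a, w b} \<in> C" using Q(3) e by simp
  qed
  have "X \<subseteq> V" "Z \<subseteq> V" using FV by (auto simp: X_def Z_def)
  have RC: "R \<subseteq> C" using FV by (auto simp: R_def)
  have fR: "finite R" using fF by (simp add: R_def)
  have agree: "w j = u j" if "w \<in> F u" "j < l" "j \<noteq> a" "j \<noteq> b" for w j
    using that by (auto simp: F_def J_def)
  text \<open>Apart from the pair itself, every constraint involves at most one of the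
    two free coordinates, so the fibre is a product set cut down to the edges of \<open>C\<close>.\<close>
  have "edges_between C X Z = R"
  proof
    show "R \<subseteq> edges_between C X Z"
      using FV by (auto simp: R_def X_def Z_def edges_between_def)
    show "edges_between C X Z \<subseteq> R"
    proof
      fix f assume "f \<in> edges_between C X Z"
      then obtain v w where vw: "v \<in> F u" "w \<in> F u" and f: "f = {v a, w b}" "f \<in> C"
        by (auto simp: X_def Z_def edges_between_def)
      \<comment> \<open>The hybrid map takes its value at \<open>b\<close> from \<open>w\<close> and
        the rest from \<open>v\<close>. As \<open>(a, b) \<notin> Q\<close>, that pair only has to
        land in \<open>C\<close>, which is \<open>f \<in> C\<close>.\<close>
      let ?t = "v(b := w b)"
      have t: "?t a = v a" "?t b = w b" using e by auto
      have tw: "?t j = w j" if "j < l" "j \<noteq> a" for j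
        using agree[OF vw(1)] agree[OF vw(2)] that by auto
      have mv: "v \<in> M Q" and mw: "w \<in> M Q" using vw by (auto simp: F_def)
      have "{?t i, ?t j} \<in> (if (i, j) \<in> Q then G else C)" if ij: "i < j" "j < l" for i j
      proof (cases "i = a \<and> j = b")
        case True
        then show ?thesis using t f Q(3) e by simp
      next
        case False
        show ?thesis
        proof (cases "i = b \<or> j = b")
          case True
          then have "i \<noteq> a" "j \<noteq> a" using False ij e by auto
          then have "?t i = w i" "?t j = w j" using ij tw by auto
          then show ?thesis using mw ij unfolding M_def clique_maps_def by simp
        next
          case False
          then show ?thesis using mv ij unfolding M_def clique_maps_def by simp
        qed
      qed
      moreover have "?t \<in> {..<l} \<rightarrow>\<^sub>E V"
        using mv FV(2)[OF vw(2)] e by (auto simp: M_def clique_maps_def PiE_def Pi_def extensional_def)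
      ultimately have "?t \<in> M Q" unfolding M_def clique_maps_def by blast
      moreover have "restrict ?t J = u" using vw(1) by (auto simp: F_def J_def restrict_def)
      ultimately have "?t \<in> F u" by (simp add: F_def)
      then show "f \<in> R" unfolding R_def using f t by (intro image_eqI) auto
    qed
  qed
  moreover have "\<rho> ^ (l * l) * \<eta> * ?n ^ 2 / 4 \<le> real (card R) \<and> real (card (R \<inter> G)) \<le> 4 * \<rho> * real (card R)"
  proof -
    \<comment> \<open>With the other images fixed by \<open>u\<close>, those of \<open>a\<close> and
      \<open>b\<close> determine the map. An edge carries at most two such ordered pairs; this
      factor 2 turns \<open>\<beta>\<close> into \<open>\<beta> / 2\<close> and
      \<open>2 * \<rho>\<close> into \<open>4 * \<rho>\<close>.\<close>
    have "inj_on (\<lambda>w. (w a, w b)) (F u)"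
    proof (rule inj_onI)
      fix v w assume vw: "v \<in> F u" "w \<in> F u" and eq: "(v a, v b) = (w a, w b)"
      have "v \<in> extensional {..<l}" "w \<in> extensional {..<l}"
        using vw by (auto simp: F_def M_def clique_maps_def PiE_def)
      then show "v = w"
      proof (rule extensionalityI)
        fix j assume "j \<in> {..<l}"
        then show "v j = w j"
          using eq agree[OF vw(1), of j] agree[OF vw(2), of j] by (cases "j = a \<or> j = b") auto
      qed
    qed
    then have "card (F u) = card ((\<lambda>w. (w a, w b)) ` F u)" by (simp add: card_image)
    also have "\<dots> \<le> card {(x, y). {x, y} \<in> R}"
    proof (rule card_mono)
      have "{(x, y). {x, y} \<in> R} \<subseteq> V \<times> V" using RC C by (auto simp: subset_iff)
      then show "finite {(x, y). {x, y} \<in> R}" using V(1) finite_subset by blast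
    qed (auto simp: R_def)
    also have "\<dots> \<le> 2 * card R" using fR RC C by (intro card_pairs_le) auto
    finally have FR: "real (card (F u)) \<le> 2 * real (card R)" by linarith
    have "R \<inter> G \<subseteq> (\<lambda>w. {w a, w b}) ` F' u" by (auto simp: R_def F'_def)
    then have "card (R \<inter> G) \<le> card (F' u)" using fF by (intro surj_card_le) (auto simp: F'_def)
    then have "real (card (R \<inter> G)) \<le> 2 * \<rho> * real (card (F u))" using u(2) by linarith
    also have "\<dots> \<le> 2 * \<rho> * (2 * real (card R))" using FR \<rho> by (intro mult_left_mono) auto
    finally show ?thesis using FR u(1) by (simp add: \<beta>_def)
  qed
  ultimately show ?thesis using \<open>X \<subseteq> V\<close> \<open>Z \<subseteq> V\<close> by (intro exI[of _ X] conjI exI[of _ Z]) auto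
qed

lemma card_small_subsets_powr_le:
  fixes \<kappa> :: real
  assumes "finite R" and "0 \<le> \<kappa>"
  shows "real (card {A. A \<subseteq> R \<and> real (card A) \<le> \<kappa>}) \<le> (real (card R) + 1) powr \<kappa>"
proof -
  let ?m = "nat \<lfloor>\<kappa>\<rfloor>"
  have "{A. A \<subseteq> R \<and> real (card A) \<le> \<kappa>} = {A. A \<subseteq> R \<and> card A \<le> ?m}"
    using assms(2) by (auto simp: le_nat_iff le_floor_iff)
  then have "card {A. A \<subseteq> R \<and> real (card A) \<le> \<kappa>} \<le> (card R + 1) ^ ?m"
    using card_small_subsets_le[OF assms(1)] by simp
  then have "real (card {A. A \<subseteq> R \<and> real (card A) \<le> \<kappa>}) \<le> real ((card R + 1) ^ ?m)"
    by (rule of_nat_mono)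
  also have "\<dots> = (real (card R) + 1) powr real ?m"
    by (simp add: powr_realpow add.commute)
  also have "\<dots> \<le> (real (card R) + 1) powr \<kappa>"
    using assms(2) by (intro powr_mono) auto
  finally show ?thesis .
qed

text \<open>A host with at most \<open>T\<close> edges has at most \<open>2 powr T\<close>
  subgraphs. In a larger host, \<open>G\<close> is recovered from a pair \<open>(X, Z)\<close>, its
  few edges between \<open>X\<close> and \<open>Z\<close>, and a free subgraph of the host without
  these edges. The bound charges a fixed number of bits to each host edge.\<close>

lemma card_free_subgraphs_le:
  fixes \<rho> \<eta> T :: real
  defines "\<theta> \<equiv> \<lambda>n l. \<rho> ^ (l * l) * \<eta> * real n ^ 2 / 4"
  assumes V: "finite V" "V \<noteq> {}" and \<rho>: "0 < \<rho>" "\<rho> \<le> 1" and \<eta>: "0 < \<eta>"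
    and many: "\<And>C. C \<subseteq> [V]\<^bsup>2\<^esup> \<Longrightarrow> T < real (card C) \<Longrightarrow>
      \<eta> * real (card V) ^ l \<le> real (card (clique_maps V l (\<lambda>_ _. C)))"
    and C: "C \<subseteq> [V]\<^bsup>2\<^esup>"
  shows "real (card {G. G \<subseteq> C \<and> clique_maps V l (\<lambda>_ _. G) = {}})
    \<le> 2 powr (T + (2 * real (card V) / \<theta> (card V) l + 4 * \<rho> * log 2 (real (card V) ^ 2 + 1)) * real (card C))"
  using C
proof (induction "card C" arbitrary: C rule: less_induct)
  case less
  let ?n = "real (card V)"
  let ?\<theta> = "\<theta> (card V) l"
  \<comment> \<open>The charge per edge: the first summand spreads the \<open>2 * ?n\<close> bits
    that name \<open>(X, Z)\<close> over at least \<open>?\<theta>\<close> deleted edges, the second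
    pays for listing at most a fraction \<open>4 * \<rho>\<close> of them.\<close>
  define \<delta> where "\<delta> = 2 * ?n / ?\<theta> + 4 * \<rho> * log 2 (?n ^ 2 + 1)"
  define free where "free = (\<lambda>C. {G. G \<subseteq> C \<and> clique_maps V l (\<lambda>_ _. G) = {}})"
  have n: "0 < ?n" using V by (simp add: card_gt_0_iff)
  have \<theta>: "0 < ?\<theta>" using \<rho> \<eta> n by (simp add: \<theta>_def)
  have "0 \<le> log 2 (?n ^ 2 + 1)" by (simp add: zero_le_log_cancel_iff add_nonneg_pos)
  then have \<delta>: "0 \<le> \<delta>" using \<rho> \<theta> by (simp add: \<delta>_def)
  have fC: "finite C" using V less.prems finite_imp_finite_nsets finite_subset by metis
  have ffree: "finite (free C')" if "C' \<subseteq> C" for C'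
    unfolding free_def by (rule finite_subset[of _ "Pow C"]) (use fC that in auto)
  show ?case
  proof (cases "T < real (card C)")
    case False
    have "card (free C) \<le> card (Pow C)" using fC by (intro card_mono) (auto simp: free_def)
    then have "real (card (free C)) \<le> real (2 ^ card C)"
      using fC by (simp only: card_Pow of_nat_le_iff)
    also have "\<dots> = 2 powr real (card C)" by (simp add: powr_realpow)
    also have "\<dots> \<le> 2 powr (T + \<delta> * real (card C))"
      using False \<delta> by (intro powr_mono) (auto simp: add_increasing2)
    finally show ?thesis by (simp add: \<delta>_def free_def)
  next
    case True
    define R where "R = (\<lambda>(X, Z). edges_between C X Z)"
    define P where "P = {p \<in> Pow V \<times> Pow V. ?\<theta> \<le> real (card (R p))}"
    define small where "small = (\<lambda>p. {A. A \<subseteq> R p \<and> real (card A) \<le> 4 * \<rho> * real (card (R p))})"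
    have RC: "R p \<subseteq> C" for p by (auto simp: R_def edges_between_def split: prod.splits)
    have fP: "finite P" using V by (simp add: P_def)
    have "card P \<le> card (Pow V \<times> Pow V)" using V by (intro card_mono) (auto simp: P_def)
    also have "\<dots> = 2 ^ (2 * card V)" using V by (simp add: card_cartesian_product card_Pow power_add mult_2)
    finally have cP: "real (card P) \<le> real (2 ^ (2 * card V))" by (simp only: of_nat_le_iff)
    have fsmall: "finite (small p)" for p
      unfolding small_def by (rule finite_subset[of _ "Pow (R p)"]) (use finite_subset[OF RC fC] in auto)
    have cover: "free C \<subseteq> (\<Union>p\<in>P. (\<lambda>(A, B). A \<union> B) ` (small p \<times> free (C - R p)))"
    proof
      fix G assume "G \<in> free C"
      then have G: "G \<subseteq> C" "clique_maps V l (\<lambda>_ _. G) = {}" by (auto simp: free_def)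
      obtain X Z where XZ: "X \<subseteq> V" "Z \<subseteq> V" "?\<theta> \<le> real (card (R (X, Z)))"
        "real (card (R (X, Z) \<inter> G)) \<le> 4 * \<rho> * real (card (R (X, Z)))"
        using sparse_dense_spot[OF V less.prems G \<rho> \<eta> many[OF less.prems True]]
        unfolding R_def \<theta>_def by auto
      have "clique_maps V l (\<lambda>_ _. G - R (X, Z)) \<subseteq> clique_maps V l (\<lambda>_ _. G)"
        by (rule clique_maps_mono) auto
      then have "G - R (X, Z) \<in> free (C - R (X, Z))" using G by (auto simp: free_def)
      moreover have "R (X, Z) \<inter> G \<in> small (X, Z)" using XZ by (auto simp: small_def)
      moreover have "G = (R (X, Z) \<inter> G) \<union> (G - R (X, Z))" by auto
      ultimately have "G \<in> (\<lambda>(A, B). A \<union> B) ` (small (X, Z) \<times> free (C - R (X, Z)))"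
        by (intro image_eqI[of _ _ "(R (X, Z) \<inter> G, G - R (X, Z))"]) auto
      moreover have "(X, Z) \<in> P" using XZ by (auto simp: P_def)
      ultimately show "G \<in> (\<Union>p\<in>P. (\<lambda>(A, B). A \<union> B) ` (small p \<times> free (C - R p)))" by blast
    qed
    \<comment> \<open>The saving \<open>2 * ?n\<close> in the exponent cancels the later sum over at
      most \<open>4 ^ card V\<close> pairs.\<close>
    have each: "real (card ((\<lambda>(A, B). A \<union> B) ` (small p \<times> free (C - R p))))
        \<le> 2 powr (T + \<delta> * real (card C) - 2 * ?n)" if p: "p \<in> P" for p
    proof -
      let ?r = "real (card (R p))"
      have fR: "finite (R p)" using finite_subset[OF RC fC] .
      have r: "?\<theta> \<le> ?r" using p by (simp add: P_def)
      have "card (R p) \<le> card C" using fC RC by (rule card_mono)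
      also have "\<dots> \<le> card V choose 2"
        using V less.prems by (metis card_mono card_nsets finite_imp_finite_nsets)
      also have "\<dots> \<le> card V * (card V - 1)" by (simp add: choose_two)
      also have "\<dots> \<le> card V ^ 2" by (simp add: power2_eq_square)
      finally have rn: "?r \<le> ?n ^ 2" by (simp flip: of_nat_power)
      have card_diff: "card (C - R p) = card C - card (R p)" "card (R p) \<le> card C"
        using fR RC fC by (auto simp: card_Diff_subset card_mono)
      have "0 < ?r" using r \<theta> by linarith
      then have "card (C - R p) < card C" using card_diff by linarith
      then have "real (card (free (C - R p))) \<le> 2 powr (T + \<delta> * real (card (C - R p)))"
        unfolding free_def \<delta>_def using less.prems by (intro less.hyps) auto
      also have "T + \<delta> * real (card (C - R p)) = T + \<delta> * real (card C) - \<delta> * ?r"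
        using card_diff by (simp add: of_nat_diff algebra_simps)
      finally have B: "real (card (free (C - R p))) \<le> 2 powr (T + \<delta> * real (card C) - \<delta> * ?r)" .
      have "real (card (small p)) \<le> (?r + 1) powr (4 * \<rho> * ?r)"
        unfolding small_def using fR \<rho> by (intro card_small_subsets_powr_le) auto
      also have "\<dots> \<le> (?n ^ 2 + 1) powr (4 * \<rho> * ?r)"
        using rn \<rho> by (intro powr_mono2) auto
      also have "\<dots> = (2 powr log 2 (?n ^ 2 + 1)) powr (4 * \<rho> * ?r)"
        by (simp add: add_nonneg_pos)
      also have "\<dots> = 2 powr (4 * \<rho> * log 2 (?n ^ 2 + 1) * ?r)"
        unfolding powr_powr by (simp add: mult_ac)
      finally have A: "real (card (small p)) \<le> 2 powr (4 * \<rho> * log 2 (?n ^ 2 + 1) * ?r)" .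
      have "2 * ?n = 2 * ?n / ?\<theta> * ?\<theta>" using \<theta> by simp
      also have "\<dots> \<le> 2 * ?n / ?\<theta> * ?r" using r \<theta> n by (intro mult_left_mono) auto
      finally have ex: "4 * \<rho> * log 2 (?n ^ 2 + 1) * ?r \<le> \<delta> * ?r - 2 * ?n"
        by (simp add: \<delta>_def algebra_simps)
      have "card ((\<lambda>(A, B). A \<union> B) ` (small p \<times> free (C - R p))) \<le> card (small p \<times> free (C - R p))"
        using fsmall ffree by (intro card_image_le) auto
      then have "real (card ((\<lambda>(A, B). A \<union> B) ` (small p \<times> free (C - R p))))
          \<le> real (card (small p)) * real (card (free (C - R p)))"
        by (simp add: card_cartesian_product flip: of_nat_mult)
      also have "\<dots> \<le> 2 powr (4 * \<rho> * log 2 (?n ^ 2 + 1) * ?r) * 2 powr (T + \<delta> * real (card C) - \<delta> * ?r)"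
        using A B by (intro mult_mono) auto
      also have "\<dots> = 2 powr (4 * \<rho> * log 2 (?n ^ 2 + 1) * ?r + (T + \<delta> * real (card C) - \<delta> * ?r))"
        by (simp add: powr_add)
      also have "\<dots> \<le> 2 powr (T + \<delta> * real (card C) - 2 * ?n)"
        using ex by (intro powr_mono) auto
      finally show ?thesis .
    qed
    have "card (free C) \<le> card (\<Union>p\<in>P. (\<lambda>(A, B). A \<union> B) ` (small p \<times> free (C - R p)))"
      using cover fP fsmall ffree by (intro card_mono) auto
    also have "\<dots> \<le> (\<Sum>p\<in>P. card ((\<lambda>(A, B). A \<union> B) ` (small p \<times> free (C - R p))))"
      using fP by (rule card_UN_le)
    finally have "real (card (free C)) \<le> (\<Sum>p\<in>P. real (card ((\<lambda>(A, B). A \<union> B) ` (small p \<times> free (C - R p)))))"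
      by (simp flip: of_nat_sum)
    also have "\<dots> \<le> real (card P) * 2 powr (T + \<delta> * real (card C) - 2 * ?n)"
      using sum_bounded_above[OF each] by simp
    also have "\<dots> \<le> 2 powr (2 * ?n) * 2 powr (T + \<delta> * real (card C) - 2 * ?n)"
      using cP powr_realpow[of 2 "2 * card V"] by (intro mult_right_mono) auto
    also have "\<dots> = 2 powr (T + \<delta> * real (card C))" by (simp flip: powr_add)
    finally show ?thesis by (simp add: \<delta>_def free_def)
  qed
qed

subsection \<open>Graphs without complete subgraphs\<close>

text \<open>Edges join distinct vertices, so a clique map is injective and its image spans a
  complete subgraph. Conversely, the inverse of an isomorphism onto the complete graph is a clique
  map.\<close>

lemma graph_free_complete_graph_iff:
  assumes "E \<subseteq> [V]\<^bsup>2\<^esup>"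
  shows "graph_free (complete_graph l) (V, E) \<longleftrightarrow> clique_maps V l (\<lambda>_ _. E) = {}"
proof (intro iffI)
  assume free: "graph_free (complete_graph l) (V, E)"
  show "clique_maps V l (\<lambda>_ _. E) = {}"
  proof (rule ccontr)
    assume "clique_maps V l (\<lambda>_ _. E) \<noteq> {}"
    then obtain w where w: "w \<in> {..<l} \<rightarrow>\<^sub>E V" "\<And>a b. a < b \<Longrightarrow> b < l \<Longrightarrow> {w a, w b} \<in> E"
      by (auto simp: clique_maps_def)
    have E: "{w a, w b} \<in> E" if "a < l" "b < l" "a \<noteq> b" for a b
      using w(2)[of a b] w(2)[of b a] that by (cases "a < b") (auto simp: insert_commute)
    have inj: "inj_on w {..<l}"
      using E assms by (intro inj_onI) (metis doubleton_in_nsets_2 lessThan_iff subsetD)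
    let ?W = "w ` {..<l}"
    have "[?W]\<^bsup>2\<^esup> \<subseteq> E" using E by (auto elim!: nsets2_E)
    moreover have "?W \<subseteq> V" using w(1) by (auto simp: PiE_def Pi_def)
    ultimately have "subgraph (?W, [?W]\<^bsup>2\<^esup>) (V, E)"
      using assms by (simp add: subgraph_def is_graph_def)
    moreover have "graph_isomorphic (?W, [?W]\<^bsup>2\<^esup>) (complete_graph l)"
    proof -
      \<comment> \<open>Map indices start at 0, the vertices of \<open>complete_graph\<close> at
        1.\<close>
      let ?\<phi> = "Suc \<circ> inv_into {..<l} w"
      have "bij_betw (inv_into {..<l} w) ?W {..<l}"
        using inj by (intro bij_betw_inv_into) (simp add: bij_betw_def)
      moreover have "bij_betw Suc {..<l} {1..l}"
        by (simp add: bij_betw_def image_Suc_lessThan)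
      ultimately have bij: "bij_betw ?\<phi> ?W {1..l}" by (rule bij_betw_trans)
      then have "{u, v} \<in> [?W]\<^bsup>2\<^esup> \<longleftrightarrow> {?\<phi> u, ?\<phi> v} \<in> [{1..l}]\<^bsup>2\<^esup>" if "u \<in> ?W" "v \<in> ?W" for u v
        using that bij_betwE[OF bij] bij_betw_imp_inj_on[OF bij]
        unfolding doubleton_in_nsets_2 by (metis inj_on_eq_iff)
      then show ?thesis using bij unfolding graph_isomorphic_def complete_graph_def
        by (intro exI[of _ ?\<phi>]) auto
    qed
    ultimately show False using free unfolding graph_free_def by blast
  qed
next
  assume empty: "clique_maps V l (\<lambda>_ _. E) = {}"
  show "graph_free (complete_graph l) (V, E)"
    unfolding graph_free_def
  proof
    assume "\<exists>G'. subgraph G' (V, E) \<and> graph_isomorphic G' (complete_graph l)"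
    then obtain W F \<phi> where sub: "W \<subseteq> V" "F \<subseteq> E" and bij: "bij_betw \<phi> W {1..l}"
      and \<phi>: "\<And>u v. u \<in> W \<Longrightarrow> v \<in> W \<Longrightarrow> {u, v} \<in> F \<longleftrightarrow> {\<phi> u, \<phi> v} \<in> [{1..l}]\<^bsup>2\<^esup>"
      by (auto simp: subgraph_def graph_isomorphic_def complete_graph_def)
    define w where "w = restrict (\<lambda>i. inv_into W \<phi> (Suc i)) {..<l}"
    have w: "w i \<in> W" "\<phi> (w i) = Suc i" if "i < l" for i
    proof -
      have "Suc i \<in> \<phi> ` W" using bij that by (auto simp: bij_betw_def)
      then show "w i \<in> W" "\<phi> (w i) = Suc i" using that
        by (auto simp: w_def inv_into_into f_inv_into_f)
    qed
    have "{w a, w b} \<in> E" if "a < b" "b < l" for a b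
    proof -
      have "{\<phi> (w a), \<phi> (w b)} \<in> [{1..l}]\<^bsup>2\<^esup>"
        using that w by (simp add: doubleton_in_nsets_2)
      then show ?thesis using \<phi> w that sub by auto
    qed
    moreover have "w \<in> {..<l} \<rightarrow>\<^sub>E V" using w sub by (auto simp: w_def)
    ultimately have "w \<in> clique_maps V l (\<lambda>_ _. E)" by (simp add: clique_maps_def)
    then show False using empty by simp
  qed
qed

lemma num_free_graphs_complete_graph:
  "num_free_graphs n (complete_graph l)
    = card {E. E \<subseteq> [{1..n}]\<^bsup>2\<^esup> \<and> clique_maps {1..n} l (\<lambda>_ _. E) = {}}"
proof -
  have "{G :: nat graph. is_graph G \<and> fst G = {1..n} \<and> graph_free (complete_graph l) G}
    = Pair {1..n} ` {E. E \<subseteq> [{1..n}]\<^bsup>2\<^esup> \<and> clique_maps {1..n} l (\<lambda>_ _. E) = {}}"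
    using graph_free_complete_graph_iff[of _ "{1..n}" l] by (auto simp: is_graph_def image_iff)
  then show ?thesis unfolding num_free_graphs_def by (simp add: card_image inj_on_def)
qed

section \<open>Lower bound from the Turan graph\<close>

text \<open>The complement of the Turan graph whose \<open>r\<close> parts are the residue classes.
  Residues permit induction on \<open>n\<close> without computing the sizes of the parts.\<close>

definition same_residue_pairs :: "nat \<Rightarrow> nat \<Rightarrow> nat set set" where
  "same_residue_pairs r n = {{x, y} | x y. 1 \<le> x \<and> x < y \<and> y \<le> n \<and> x mod r = y mod r}"

text \<open>The new vertex n + 1 is congruent to at most \<open>n div r\<close> earlier ones, namely
  n + 1 - r q with q from 1 to \<open>n div r\<close>. Summing k / r over k < n gives
  \<open>(n choose 2) / r\<close> without an error term.\<close>

lemma card_same_residue_pairs_le: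
  assumes "0 < r"
  shows "finite (same_residue_pairs r n) \<and> real (card (same_residue_pairs r n)) \<le> real (n choose 2) / real r"
proof (induction n)
  case 0
  have "same_residue_pairs r 0 = {}" by (auto simp: same_residue_pairs_def)
  then show ?case by simp
next
  case (Suc n)
  let ?f = "\<lambda>q. {Suc n - r * q, Suc n}"
  have sub: "same_residue_pairs r (Suc n) \<subseteq> same_residue_pairs r n \<union> ?f ` {1..n div r}"
  proof
    fix e assume "e \<in> same_residue_pairs r (Suc n)"
    then obtain x y where e: "e = {x, y}" "1 \<le> x" "x < y" "y \<le> Suc n" "x mod r = y mod r"
      by (auto simp: same_residue_pairs_def)
    show "e \<in> same_residue_pairs r n \<union> ?f ` {1..n div r}"
    proof (cases "y = Suc n")
      case False
      then show ?thesis using e by (auto simp: same_residue_pairs_def)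
    next
      case True
      then have "r dvd Suc n - x" using e mod_eq_dvd_iff_nat[of x "Suc n" r] by simp
      then obtain q where q: "Suc n - x = r * q" by (elim dvdE)
      have "q \<noteq> 0" using q e True by (intro notI) simp
      moreover have "q \<le> n div r"
        using q e(2) assms by (simp add: less_eq_div_iff_mult_less_eq mult.commute)
      moreover have "x = Suc n - r * q" using q e True by simp
      ultimately show ?thesis using e True by (intro UnI2 image_eqI[of _ _ q]) auto
    qed
  qed
  have fin: "finite (same_residue_pairs r n \<union> ?f ` {1..n div r})" using Suc by simp
  have "card (same_residue_pairs r (Suc n)) \<le> card (same_residue_pairs r n \<union> ?f ` {1..n div r})"
    using fin sub by (rule card_mono)
  also have "\<dots> \<le> card (same_residue_pairs r n) + card (?f ` {1..n div r})" by (rule card_Un_le)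
  also have "\<dots> \<le> card (same_residue_pairs r n) + n div r"
    using card_image_le[of "{1..n div r}" ?f] by simp
  finally have "real (card (same_residue_pairs r (Suc n))) \<le> real (n choose 2) / real r + real (n div r)"
    using Suc by linarith
  also have "\<dots> \<le> real (n choose 2) / real r + real n / real r"
    using assms by (simp add: le_divide_eq flip: of_nat_mult)
  also have "\<dots> = real (Suc n choose 2) / real r"
    by (simp add: numeral_2_eq_2 add_divide_distrib)
  finally show ?case using finite_subset[OF sub fin] by simp
qed

text \<open>By pigeonhole, two of \<open>l\<close> vertices share one of the \<open>l - 1\<close>
  residues and are not joined, so every subset of the Turan graph's edges is free.\<close>

lemma log_num_free_graphs_ge:
  assumes "2 \<le> l"
  shows "(1 - 1 / (real l - 1)) * real (n choose 2) \<le> log 2 (real (num_free_graphs n (complete_graph l)))"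
proof -
  define r where "r = l - 1"
  have r: "0 < r" "real r = real l - 1" "r < l" using assms by (auto simp: r_def of_nat_diff)
  let ?D = "same_residue_pairs r n"
  define T where "T = [{1..n}]\<^bsup>2\<^esup> - ?D"
  have fT: "finite T" by (simp add: T_def finite_imp_finite_nsets)
  have "card ([{1..n}]\<^bsup>2\<^esup>) - card ?D \<le> card T"
    unfolding T_def using card_same_residue_pairs_le[OF r(1)] by (intro diff_card_le_card_Diff) auto
  then have "real (n choose 2) \<le> real (card T) + real (card ?D)"
    by (simp add: card_nsets flip: of_nat_add)
  then have cT: "(1 - 1 / (real l - 1)) * real (n choose 2) \<le> real (card T)"
    using card_same_residue_pairs_le[OF r(1), of n] r(2) by (simp add: algebra_simps)
  have free: "clique_maps {1..n} l (\<lambda>_ _. E) = {}" if "E \<subseteq> T" for E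
  proof (rule ccontr)
    assume "clique_maps {1..n} l (\<lambda>_ _. E) \<noteq> {}"
    then obtain w where "w \<in> clique_maps {1..n} l (\<lambda>_ _. E)" by blast
    then have w: "{w a, w b} \<in> T" if "a < b" "b < l" for a b
      using that \<open>E \<subseteq> T\<close> by (auto simp: clique_maps_def)
    have neq: "w a mod r \<noteq> w b mod r" if "a < b" "b < l" for a b
    proof
      assume eq: "w a mod r = w b mod r"
      have "w a \<in> {1..n}" "w b \<in> {1..n}" "w a \<noteq> w b" "{w a, w b} \<notin> ?D"
        using w[OF that] by (auto simp: T_def)
      moreover have "{w a, w b} \<in> ?D \<or> {w b, w a} \<in> ?D"
        using calculation(1-3) eq unfolding same_residue_pairs_def
        by (cases "w a < w b") (fastforce simp: not_less)+
      ultimately show False by (simp add: insert_commute)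
    qed
    have "inj_on (\<lambda>i. w i mod r) {..<l}"
      using neq by (intro linorder_inj_onI) auto
    moreover have "(\<lambda>i. w i mod r) ` {..<l} \<subseteq> {..<r}" using r by auto
    ultimately have "card {..<l} \<le> card {..<r}" by (intro card_inj_on_le) auto
    then show False using r(3) by simp
  qed
  have "card (Pow T) \<le> num_free_graphs n (complete_graph l)"
    unfolding num_free_graphs_complete_graph
  proof (rule card_mono)
    show "finite {E. E \<subseteq> [{1..n}]\<^bsup>2\<^esup> \<and> clique_maps {1..n} l (\<lambda>_ _. E) = {}}"
      by (rule finite_subset[of _ "Pow ([{1..n}]\<^bsup>2\<^esup>)"]) (auto simp: finite_imp_finite_nsets)
  qed (use free in \<open>auto simp: T_def\<close>)
  then have "real (2 ^ card T) \<le> real (num_free_graphs n (complete_graph l))"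
    using fT by (simp only: card_Pow of_nat_le_iff)
  then have "real (card T) \<le> log 2 (real (num_free_graphs n (complete_graph l)))"
    by (intro le_log_of_power) simp_all
  then show ?thesis using cT by linarith
qed

section \<open>Upper bound from containers\<close>

text \<open>Supersaturation supplies the container bound with
  \<open>\<eta> = \<gamma> ^ (2 * l)\<close>, and the first host is the complete graph on all
  vertices.\<close>

lemma log_num_free_graphs_le:
  fixes \<gamma> \<rho> :: real
  assumes n: "0 < n" and l: "2 \<le> l" and \<gamma>: "0 < \<gamma>" "\<gamma> \<le> 1 / (real l - 1)" and \<rho>: "0 < \<rho>" "\<rho> \<le> 1"
  shows "log 2 (real (num_free_graphs n (complete_graph l)))
    \<le> (1 - 1 / (real l - 1) + \<gamma>) * (real n ^ 2 + real n) / 2 + (\<gamma> * real n) ^ 2 / 2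
      + (2 * real n / (\<rho> ^ (l * l) * \<gamma> ^ (2 * l) * real n ^ 2 / 4) + 4 * \<rho> * log 2 (real n ^ 2 + 1))
        * real (n choose 2)"
    (is "_ \<le> ?T + ?\<delta> * _")
proof -
  let ?V = "{1..n}"
  have many: "\<gamma> ^ (2 * l) * real (card ?V) ^ l \<le> real (card (clique_maps ?V l (\<lambda>_ _. C)))"
    if "C \<subseteq> [?V]\<^bsup>2\<^esup>" "?T < real (card C)" for C
    using clique_supersaturation[of ?V C l \<gamma>] that l \<gamma>
    by (simp add: power_mult_distrib power_mult)
  have "real (num_free_graphs n (complete_graph l)) \<le> 2 powr (?T + ?\<delta> * real (n choose 2))"
    unfolding num_free_graphs_complete_graph
    using card_free_subgraphs_le[OF _ _ \<rho> _ many, where C = "[?V]\<^bsup>2\<^esup>"] n \<gamma>(1)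
    by (simp add: card_nsets)
  \<comment> \<open>Taking logarithms requires a positive count. The empty edge set is free because
    \<open>2 \<le> l\<close> imposes a constraint on at least one pair.\<close>
  moreover have "0 < num_free_graphs n (complete_graph l)"
  proof (rule ccontr)
    assume "\<not> ?thesis"
    then have "card {E. E \<subseteq> [?V]\<^bsup>2\<^esup> \<and> clique_maps ?V l (\<lambda>_ _. E) = {}} = 0"
      by (simp add: num_free_graphs_complete_graph)
    moreover have "finite {E. E \<subseteq> [?V]\<^bsup>2\<^esup> \<and> clique_maps ?V l (\<lambda>_ _. E) = {}}"
      by (rule finite_subset[of _ "Pow ([?V]\<^bsup>2\<^esup>)"]) (auto simp: finite_imp_finite_nsets)
    moreover have "clique_maps ?V l (\<lambda>_ _. {}) = {}" using l by (force simp: clique_maps_def)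
    ultimately show False by auto
  qed
  ultimately show ?thesis by (simp add: log_le_iff)
qed

section \<open>Choice of parameters and asymptotics\<close>

theorem theorem1:
  fixes l :: "nat \<Rightarrow> nat"
  assumes "\<And>n. l n > 0"
    and "\<forall>\<^sub>F n in sequentially. 3 \<le> l n \<and> real (l n) \<le> ln (real n) powr (1/4) / 2"
  shows "\<exists>g :: nat \<Rightarrow> real.
    (\<lambda>n. g n * real (l n) / real n ^ 2) \<longlonglongrightarrow> 0 \<and>
    (\<forall>\<^sub>F n in sequentially.
       log 2 (real (num_free_graphs n (complete_graph (l n)))) =
         (1 - 1 / (real (l n) - 1)) * real (n choose 2) + g n)"
proof -
  \<comment> \<open>The error term is the exact difference, so only its limit needs proof.\<close>
  define g where "g = (\<lambda>n. log 2 (real (num_free_graphs n (complete_graph (l n))))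
    - (1 - 1 / (real (l n) - 1)) * real (n choose 2))"
  define L where "L = (\<lambda>n. ln (real n))"
  \<comment> \<open>Bounds \<open>g n / n ^ 2\<close> for \<open>\<gamma> = 1 / L n\<close> and
    \<open>\<rho> = 1 / L n ^ 2\<close>. The summands come from the linear terms, from
    \<open>\<gamma>\<close>, from naming the vertex sets and from listing edges.\<close>
  define B where "B = (\<lambda>n. 1 / real n + 2 / L n + 8 * L n powr (L n powr (1/2)) / real n
    + 4 * log 2 (real n ^ 2 + 1) / L n ^ 2)"
  have bounds: "0 \<le> g n * real (l n) / real n ^ 2 \<and> g n * real (l n) / real n ^ 2 \<le> L n powr (1/4) * B n"
    if l3: "3 \<le> l n" and lL: "real (l n) \<le> L n powr (1/4) / 2" and L1: "1 \<le> L n" for n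
  proof -
    let ?l = "real (l n)" and ?n = "real n" and ?L = "L n"
    \<comment> \<open>Since \<open>ln 0 = 0\<close>, the bound \<open>1 \<le> L n\<close> excludes
      \<open>n = 0\<close>.\<close>
    have n0: "0 < n" using L1 by (cases n) (auto simp: L_def)
    then have n1: "1 \<le> ?n" by simp
    have g0: "0 \<le> g n" using log_num_free_graphs_ge[of "l n" n] l3 by (simp add: g_def)
    have lL': "?l \<le> ?L powr (1/4)" using lL l3 by linarith
    also have "\<dots> \<le> ?L powr 1" using L1 by (intro powr_mono) auto
    finally have "?l \<le> ?L" using L1 by simp
    then have \<gamma>: "1 / ?L \<le> 1 / (?l - 1)" using l3 by (intro divide_left_mono) auto
    have "log 2 (real (num_free_graphs n (complete_graph (l n))))
      \<le> (1 - 1 / (?l - 1) + 1 / ?L) * (?n ^ 2 + ?n) / 2 + (1 / ?L * ?n) ^ 2 / 2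
      + (2 * ?n / ((1 / ?L ^ 2) ^ (l n * l n) * (1 / ?L) ^ (2 * l n) * ?n ^ 2 / 4)
         + 4 * (1 / ?L ^ 2) * log 2 (?n ^ 2 + 1)) * real (n choose 2)" (is "_ \<le> ?T + ?\<delta> * _")
      using n0 l3 L1 \<gamma> by (intro log_num_free_graphs_le) auto
    moreover have "?T - (1 - 1 / (?l - 1)) * real (n choose 2) \<le> ?n + 2 / ?L * ?n ^ 2"
    proof -
      have c2: "real (n choose 2) = ?n * (?n - 1) / 2" using n0 by (cases n) (simp_all add: choose_two real_of_nat_div algebra_simps)
      have nn: "?n \<le> ?n ^ 2" using n1 by (simp add: power2_eq_square)
      \<comment> \<open>With \<open>c = 1 / (?l - 1)\<close> and \<open>k = 1 / ?L\<close>, the main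
        quadratic terms cancel; a linear term and multiples of \<open>k\<close> remain.\<close>
      have id: "(1 - c + k) * (x ^ 2 + x) / 2 + (k * x) ^ 2 / 2 - (1 - c) * (x * (x - 1) / 2)
        = (1 - c) * x + k * ((x ^ 2 + x) / 2) + k ^ 2 * (x ^ 2 / 2)" for c k x :: real
        by (simp add: power2_eq_square field_simps)
      have "?T - (1 - 1 / (?l - 1)) * real (n choose 2)
        = (1 - 1 / (?l - 1)) * ?n + 1 / ?L * ((?n ^ 2 + ?n) / 2) + (1 / ?L) ^ 2 * (?n ^ 2 / 2)"
        unfolding c2 by (rule id)
      also have "\<dots> \<le> 1 * ?n + 1 / ?L * ?n ^ 2 + 1 / ?L * ?n ^ 2"
        using l3 L1 n1 nn
        by (intro add_mono mult_mono) (auto simp: power2_eq_square divide_le_eq)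
      finally show ?thesis by simp
    qed
    moreover have "?\<delta> * real (n choose 2) \<le> (8 * ?L powr (?L powr (1/2)) / ?n
        + 4 * log 2 (?n ^ 2 + 1) / ?L ^ 2) * ?n ^ 2"
    proof -
      have "(1 / ?L ^ 2) ^ (l n * l n) * (1 / ?L) ^ (2 * l n) = 1 / ?L ^ (2 * (l n * l n) + 2 * l n)"
        by (simp add: power_add power_mult power_one_over)
      then have "?\<delta> = 8 * ?L ^ (2 * (l n * l n) + 2 * l n) / ?n + 4 * log 2 (?n ^ 2 + 1) / ?L ^ 2"
        using n1 by (simp add: power2_eq_square)
      \<comment> \<open>The exponent is at most \<open>(2 * ?l) ^ 2\<close>, which the fourth-root
        bound on \<open>l n\<close> keeps below \<open>?L powr (1/2)\<close>.\<close>
      moreover have "?L ^ (2 * (l n * l n) + 2 * l n) \<le> ?L powr (?L powr (1/2))"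
      proof -
        have "2 * ?l \<le> ?L powr (1/4)" using lL by simp
        then have "(2 * ?l) * (2 * ?l) \<le> ?L powr (1/4) * ?L powr (1/4)"
          by (intro mult_mono) auto
        also have "\<dots> = ?L powr (1/2)" by (simp flip: powr_add)
        finally have "4 * (?l * ?l) \<le> ?L powr (1/2)" by simp
        moreover have "1 * ?l \<le> ?l * ?l" using l3 by (intro mult_right_mono) auto
        ultimately have "real (2 * (l n * l n) + 2 * l n) \<le> ?L powr (1/2)" by simp
        then have "?L powr real (2 * (l n * l n) + 2 * l n) \<le> ?L powr (?L powr (1/2))"
          using L1 by (intro powr_mono) auto
        then show ?thesis using L1 powr_realpow[of ?L "2 * (l n * l n) + 2 * l n"] by simp
      qed
      ultimately have le: "?\<delta> \<le> 8 * ?L powr (?L powr (1/2)) / ?n + 4 * log 2 (?n ^ 2 + 1) / ?L ^ 2"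
        using n1 by (simp add: divide_right_mono)
      have "n choose 2 \<le> n * (n - 1)" by (simp add: choose_two)
      also have "\<dots> \<le> n ^ 2" by (simp add: power2_eq_square)
      finally have c: "real (n choose 2) \<le> ?n ^ 2" by (simp flip: of_nat_power)
      have "0 \<le> log 2 (?n ^ 2 + 1)" by (simp add: zero_le_log_cancel_iff add_nonneg_pos)
      then show ?thesis using n1 by (intro mult_mono[OF le c]) auto
    qed
    ultimately have "g n \<le> ?n + 2 / ?L * ?n ^ 2 + (8 * ?L powr (?L powr (1/2)) / ?n
        + 4 * log 2 (?n ^ 2 + 1) / ?L ^ 2) * ?n ^ 2"
      unfolding g_def by linarith
    also have "\<dots> = B n * ?n ^ 2"
      using n1 by (simp add: B_def distrib_right power2_eq_square)
    finally have "g n / ?n ^ 2 \<le> B n" using n1 by (simp add: divide_le_eq)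
    then have "?l * (g n / ?n ^ 2) \<le> ?L powr (1/4) * B n"
      using lL' g0 by (intro mult_mono) auto
    then show ?thesis using g0 by (simp add: mult.commute)
  qed
  have "\<forall>\<^sub>F n in sequentially. 1 \<le> L n" unfolding L_def by real_asymp
  with assms(2) have ev: "\<forall>\<^sub>F n in sequentially. 0 \<le> g n * real (l n) / real n ^ 2 \<and>
      g n * real (l n) / real n ^ 2 \<le> L n powr (1/4) * B n"
    by eventually_elim (use bounds L_def in auto)
  \<comment> \<open>Each summand of \<open>B\<close> is o(\<open>L n powr (-1/4)\<close>):
    \<open>L n powr (L n powr (1/2))\<close> is n to a power tending to 0, and
    \<open>log 2 (real n ^ 2 + 1)\<close> has the order of \<open>L n\<close>.\<close>
  have lim: "(\<lambda>n. L n powr (1/4) * B n) \<longlonglongrightarrow> 0"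
    unfolding L_def B_def by real_asymp
  have "(\<lambda>n. g n * real (l n) / real n ^ 2) \<longlonglongrightarrow> 0"
    by (rule tendsto_sandwich[OF _ _ tendsto_const lim])
       (use ev in \<open>auto elim: eventually_mono\<close>)
  then show ?thesis by (intro exI[of _ g]) (simp add: g_def)
qed

end
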